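(* For any super-symmetric fourth-order tensor $\mathcal{F}\in\mathbb{S}^{n^4}$, $$\operatorname{rank}_{M}(\mathcal{F})\le\operatorname{rank}_{SCP}(\mathcal{F})\le n^2\,\operatorname{rank}_{M}(\mathcal{F}).$$
   Context: $\mathbb{S}^{n^{k}}$ denotes the set of $k$-th order complex tensors of dimension $n\times\cdots\times n$ whose entries are invariant under every permutation of the indices (super-symmetric tensors). $\otimes$ is the outer product. The symmetric CP-rank $\operatorname{rank}_{SCP}(\mathcal{F})$ of $\mathcal{F}\in\mathbb{S}^{n^k}$ is the smallest integer $r$ such that $\mathcal{F}=\sum_{i=1}^r\underbrace{a^i\otimes\cdots\otimes a^i}_{k}$ with $a^i\in\mathbb{C}^n$. For $\mathcal{F}\in\mathbb{S}^{n^4}$, the M-rank $\operatorname{rank}_M(\mathcal{F})$ is the rank of the square unfolding $\boldsymbol{M}(\mathcal{F})\in\mathbb{C}^{n^2\times n^2}$, the matrix whose rows are indexed by $(i_1,i_2)$, whose columns are indexed by $(i_3,i_4)$, with corresponding entry $\mathcal{F}_{i_1i_2i_3i_4}$ (by super-symmetry, permuting the indices first does not change it). *)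

theory Defs
  imports "HOL-Analysis.Analysis" "HOL-Library.Extended_Nat" "HOL-Combinatorics.Permutations"
begin

text \<open>A complex tensor of order \<open>k = CARD('k)\<close> and dimension \<open>n \<times> \<dots> \<times> n\<close>, \<open>n = CARD('n)\<close>,
  is a family of complex numbers indexed by the multi-indices \<open>i \<in> 'n ^ 'k\<close>.\<close>

type_synonym ('n, 'k) tensor = "complex ^ ('n ^ 'k)"

definition super_symmetric :: "('n::finite, 'k::finite) tensor \<Rightarrow> bool" where
  "super_symmetric F \<longleftrightarrow> (\<forall>p i. p permutes UNIV \<longrightarrow> F $ (\<chi> j. i $ p j) = F $ i)"

text \<open>The \<open>k\<close>-fold outer product \<open>a \<otimes> \<dots> \<otimes> a\<close>.\<close>

definition outer_power :: "complex ^ 'n \<Rightarrow> ('n::finite, 'k::finite) tensor" where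
  "outer_power a = (\<chi> i. \<Prod>j\<in>UNIV. a $ (i $ j))"

text \<open>The value is an extended natural number, so that a tensor without any symmetric
  decomposition would have rank \<open>\<infinity>\<close> rather than an unspecified number.\<close>

definition rank_SCP :: "('n::finite, 'k::finite) tensor \<Rightarrow> enat" where
  "rank_SCP F = Inf {enat r | r. \<exists>a :: nat \<Rightarrow> complex ^ 'n. F = (\<Sum>i<r. outer_power (a i))}"

text \<open>The four positions are the elements 1, 2, 3 and 4 = 0 of the numeral type \<open>4\<close>.\<close>

definition multi_index4 :: "'n \<Rightarrow> 'n \<Rightarrow> 'n \<Rightarrow> 'n \<Rightarrow> 'n ^ 4" where
  "multi_index4 i1 i2 i3 i4 =
     (\<chi> j. if j = 1 then i1 else if j = 2 then i2 else if j = 3 then i3 else i4)"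

definition square_unfolding ::
  "('n::finite, 4) tensor \<Rightarrow> complex ^ ('n \<times> 'n) ^ ('n \<times> 'n)" where
  "square_unfolding F = (\<chi> row col. F $ multi_index4 (fst row) (snd row) (fst col) (snd col))"

definition rank_M :: "('n::finite, 4) tensor \<Rightarrow> nat" where
  "rank_M F = rank (square_unfolding F)"

end

theory Submission
  imports Defs
begin

text \<open>
  Write \<open>n = CARD('n)\<close> and let \<open>r\<close> be the rank of the unfolding \<open>M\<close> of \<open>F\<close>.

  For the lower bound, a term \<open>a \<otimes> a \<otimes> a \<otimes> a\<close> unfolds to the matrix \<open>(a \<otimes> a) (a \<otimes> a)\<^sup>T\<close>
  of rank at most 1, so a decomposition of \<open>F\<close> into \<open>s\<close> such terms puts all rows of \<open>M\<close> in the
  span of \<open>s\<close> vectors (\<open>rank_M_le_number_of_outer_powers\<close>).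

  For the upper bound, a complex symmetric matrix of rank \<open>r\<close> is a sum of \<open>r\<close> matrices \<open>x x\<^sup>T\<close>
  with \<open>x\<close> in its row space (\<open>symmetric_matrix_sum_squares\<close>). Super-symmetry makes \<open>M\<close>
  symmetric, so \<open>M\<close> is such a sum; it also makes every row of \<open>M\<close> a symmetric \<open>n \<times> n\<close> matrix,
  and hence so is every \<open>x\<close>. Applying the same lemma to each \<open>x\<close> gives
  \<open>x = u\<^sub>1 u\<^sub>1\<^sup>T + \<dots> + u\<^sub>n u\<^sub>n\<^sup>T\<close>. In terms of quartic forms, \<open>F\<close> is now a sum of \<open>r\<close> squares
  \<open>(l\<^sub>1\<^sup>2 + \<dots> + l\<^sub>n\<^sup>2)\<^sup>2\<close> with linear forms \<open>l\<^sub>p\<close>, and it remains to write such a square as a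
  combination of \<open>n\<^sup>2\<close> fourth powers. This follows from the identity
  \<open>(a + \<i> b)\<^sup>4 + (b + \<i> a)\<^sup>4 = 2 a\<^sup>4 - 12 a\<^sup>2 b\<^sup>2 + 2 b\<^sup>4\<close>,
  which expresses the products \<open>l\<^sub>p\<^sup>2 l\<^sub>q\<^sup>2\<close> by pure powers \<open>l\<^sub>p\<^sup>4\<close> and the \<open>n\<^sup>2\<close> fourth powers of
  \<open>l\<^sub>p + \<i> l\<^sub>q\<close>. The pure powers cost nothing extra, since \<open>l\<^sub>p + \<i> l\<^sub>p\<close> is a multiple of \<open>l\<^sub>p\<close>
  (\<open>symmetrized_square_eq_fourth_powers\<close>). Finally, coefficients disappear because complex
  numbers have fourth roots (\<open>rank_SCP_le_card\<close>).
\<close>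

section \<open>Complex symmetric matrices as sums of squares\<close>

text \<open>
  Polarization: if the quadratic form of \<open>B\<close> vanishes at two basis vectors, then its value at
  their sum is twice the corresponding off-diagonal entry.
\<close>

lemma symmetric_matrix_nonisotropic:
  fixes B :: "complex ^ 'm ^ 'm"
  assumes sym: "\<And>i j. B $ i $ j = B $ j $ i" and nz: "B \<noteq> 0"
  obtains v where "(\<Sum>i\<in>UNIV. v $ i * (B *v v) $ i) \<noteq> 0"
proof -
  have single: "(\<Sum>i\<in>UNIV. axis p 1 $ i * y $ i) = y $ p" for p and y :: "complex ^ 'm"
  proof -
    have "(\<Sum>i\<in>UNIV. axis p 1 $ i * y $ i) = (\<Sum>i\<in>UNIV. if i = p then y $ i else 0)"
      by (rule sum.cong) (auto simp: axis_def)
    then show ?thesis by simp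
  qed
  have entry: "(B *v axis q 1) $ p = B $ p $ q" for p q
    by (simp add: matrix_vector_mult_def axis_def if_distrib[of "(*) _"] cong: if_cong)
  obtain p q where pq: "B $ p $ q \<noteq> 0"
    using nz by (auto simp: vec_eq_iff)
  show thesis
  proof (cases "B $ p $ p = 0 \<and> B $ q $ q = 0")
    case False
    moreover have "(\<Sum>i\<in>UNIV. axis j 1 $ i * (B *v axis j 1) $ i) = B $ j $ j" for j
      unfolding single by (rule entry)
    ultimately show thesis using that by metis
  next
    case True
    define z :: "complex ^ 'm" where "z = axis p 1 + axis q 1"
    have "(\<Sum>i\<in>UNIV. z $ i * (B *v z) $ i) = (B *v z) $ p + (B *v z) $ q"
      by (simp only: z_def vector_add_component distrib_right sum.distrib single)
    also have "\<dots> = 2 * B $ p $ q"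
      using True sym[of p q]
      by (simp add: z_def matrix_vector_right_distrib entry)
    finally show thesis using that[of z] pq by simp
  qed
qed

text \<open>
  Wedderburn's rank reduction. For \<open>v\<close> with \<open>v\<^sup>T B v \<noteq> 0\<close> and \<open>w = B v\<close>, subtracting
  \<open>w w\<^sup>T / (v\<^sup>T B v)\<close> from \<open>B\<close> makes every row orthogonal to \<open>v\<close> (for the bilinear, not the
  Hermitian form). The vector \<open>w\<close> lies in the row space but is not orthogonal to \<open>v\<close>, so the
  dimension drops. With \<open>d\<close> an upper bound of the dimension, zero vectors can pad the sum when
  the process stops early.
\<close>

lemma symmetric_matrix_sum_squares:
  fixes B :: "complex ^ 'm ^ 'm"
  assumes "vec.subspace V" and "vec.dim V \<le> d"
    and "\<And>i. B $ i \<in> V" and "\<And>i j. B $ i $ j = B $ j $ i"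
  obtains x :: "nat \<Rightarrow> complex ^ 'm" where "\<And>k. x k \<in> V"
    and "\<And>i j. B $ i $ j = (\<Sum>k<d. x k $ i * x k $ j)"
proof -
  have "\<exists>x :: nat \<Rightarrow> complex ^ 'm. (\<forall>k. x k \<in> V) \<and> (\<forall>i j. B $ i $ j = (\<Sum>k<d. x k $ i * x k $ j))"
    using assms
  proof (induction d arbitrary: B V)
    case 0
    then have "B $ i = 0" for i
      using vec.dim_eq_0[of V] by blast
    then show ?case using 0 by (intro exI[of _ "\<lambda>_. 0"]) (simp add: vec.subspace_0)
  next
    case (Suc d)
    show ?case
    proof (cases "B = 0")
      case True
      then show ?thesis using Suc.prems(1) by (intro exI[of _ "\<lambda>_. 0"]) (simp add: vec.subspace_0)
    next
      case False
      then obtain v where v: "(\<Sum>i\<in>UNIV. v $ i * (B *v v) $ i) \<noteq> 0"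
        using symmetric_matrix_nonisotropic Suc.prems(4) by blast
      define w where "w = B *v v"
      define \<phi> where "\<phi> y = (\<Sum>i\<in>UNIV. v $ i * y $ i)" for y :: "complex ^ 'm"
      define V' where "V' = {y \<in> V. \<phi> y = 0}"
      have s: "\<phi> w \<noteq> 0" using v by (simp add: w_def \<phi>_def)
      have \<phi>_add: "\<phi> (y + z) = \<phi> y + \<phi> z" and \<phi>_scale: "\<phi> (c *s y) = c * \<phi> y" for y z c
        by (simp_all add: \<phi>_def distrib_left sum.distrib sum_distrib_left mult.left_commute)
      have \<phi>_diff: "\<phi> (y - z) = \<phi> y - \<phi> z" for y z
        using \<phi>_add[of "y - z" z] by simp
      have row: "\<phi> (B $ i) = w $ i" for i
        by (simp add: \<phi>_def w_def matrix_vector_mult_def mult.commute)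
      have "w = (\<Sum>j\<in>UNIV. v $ j *s B $ j)"
        using Suc.prems(4) by (simp add: w_def vec_eq_iff matrix_vector_mult_def mult.commute)
      then have wV: "w \<in> V"
        using Suc.prems(1,3) by (simp add: vec.subspace_sum vec.subspace_scale)
      have \<phi>0: "\<phi> 0 = 0" by (simp add: \<phi>_def)
      have subV': "vec.subspace V'"
        using Suc.prems(1) unfolding V'_def vec.subspace_def by (auto simp: \<phi>_add \<phi>_scale \<phi>0)
      have "V' \<subset> V" using wV s by (auto simp: V'_def)
      then have "vec.dim V' < vec.dim V"
        using vec.dim_psubset[of V' V] vec.span_eq_iff subV' Suc.prems(1) by metis
      then have dimV': "vec.dim V' \<le> d" using Suc.prems(2) by simp
      define B' where "B' = (\<chi> i. B $ i - (w $ i / \<phi> w) *s w)"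
      have B'row: "B' $ i \<in> V'" for i
        using Suc.prems(1,3) wV s
        by (simp add: B'_def V'_def \<phi>_diff \<phi>_scale row vec.subspace_diff vec.subspace_scale)
      have B'sym: "B' $ i $ j = B' $ j $ i" for i j
        using Suc.prems(4)[of i j] by (simp add: B'_def)
      obtain x where x: "\<And>k. x k \<in> V'" "\<And>i j. B' $ i $ j = (\<Sum>k<d. x k $ i * x k $ j)"
        using Suc.IH[of V' B', OF subV' dimV' B'row B'sym] by blast
      define y where "y = x(d := (1 / csqrt (\<phi> w)) *s w)"
      have "y k \<in> V" for k
        using x(1)[of k] wV Suc.prems(1) by (simp add: y_def V'_def vec.subspace_scale)
      moreover have "B $ i $ j = (\<Sum>k<Suc d. y k $ i * y k $ j)" for i j
      proof -
        have "csqrt (\<phi> w) * csqrt (\<phi> w) = \<phi> w"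
          using power2_csqrt[of "\<phi> w"] by (simp add: power2_eq_square)
        then have "y d $ i * y d $ j = w $ i * w $ j / \<phi> w" by (simp add: y_def)
        moreover have "(\<Sum>k<d. y k $ i * y k $ j) = B' $ i $ j" by (simp add: y_def x(2))
        ultimately show ?thesis by (simp add: B'_def)
      qed
      ultimately show ?thesis by blast
    qed
  qed
  then show thesis using that by blast
qed

section \<open>Fourth-order tensors\<close>

lemma multi_index4_component [simp]:
  "multi_index4 i j k l $ 1 = i" "multi_index4 i j k l $ 2 = j"
  "multi_index4 i j k l $ 3 = k" "multi_index4 i j k l $ 4 = l"
  by (simp_all add: multi_index4_def)

lemma multi_index4_eta: "multi_index4 (i $ 1) (i $ 2) (i $ 3) (i $ 4) = i"
  by (simp add: vec_eq_iff forall_4)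

lemma tensor4_eqI:
  fixes F G :: "('n::finite, 4) tensor"
  assumes "\<And>i j k l. F $ multi_index4 i j k l = G $ multi_index4 i j k l"
  shows "F = G"
proof -
  have "F $ m = G $ m" for m
    using assms[of "m $ 1" "m $ 2" "m $ 3" "m $ 4"] by (simp only: multi_index4_eta)
  then show ?thesis by (simp add: vec_eq_iff)
qed

lemma outer_power_multi_index4 [simp]:
  "outer_power a $ multi_index4 i j k l = a $ i * a $ j * a $ k * a $ l"
proof -
  have "(\<Prod>m\<in>UNIV. f m) = f 1 * f 2 * f 3 * f 4" for f :: "4 \<Rightarrow> complex"
    unfolding UNIV_4 by (simp add: mult.assoc)
  then show ?thesis by (simp add: outer_power_def)
qed

lemma super_symmetric_swap:
  fixes F :: "('n::finite, 4) tensor"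
  assumes "super_symmetric F"
  shows "F $ multi_index4 j i k l = F $ multi_index4 i j k l"
    and "F $ multi_index4 i k j l = F $ multi_index4 i j k l"
    and "F $ multi_index4 i j l k = F $ multi_index4 i j k l"
proof -
  have *: "F $ (\<chi> m. multi_index4 i j k l $ Transposition.transpose p q m) = F $ multi_index4 i j k l" for p q
    using assms permutes_swap_id[of p UNIV q] unfolding super_symmetric_def by blast
  have "(\<chi> m. multi_index4 i j k l $ Transposition.transpose 1 2 m) = multi_index4 j i k l"
       "(\<chi> m. multi_index4 i j k l $ Transposition.transpose 2 3 m) = multi_index4 i k j l"
       "(\<chi> m. multi_index4 i j k l $ Transposition.transpose 3 4 m) = multi_index4 i j l k"
    by (simp_all add: vec_eq_iff forall_4 Transposition.transpose_def)
  then show "F $ multi_index4 j i k l = F $ multi_index4 i j k l"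
    and "F $ multi_index4 i k j l = F $ multi_index4 i j k l"
    and "F $ multi_index4 i j l k = F $ multi_index4 i j k l"
    using *[of 1 2] *[of 2 3] *[of 3 4] by simp_all
qed

lemma square_unfolding_outer_powers:
  assumes "F = (\<Sum>m<r. outer_power (a m))"
  shows "square_unfolding F $ (i, j) = (\<Sum>m<r. (a m $ i * a m $ j) *s (\<chi> kl. a m $ fst kl * a m $ snd kl))"
  by (simp add: assms vec_eq_iff square_unfolding_def sum_component mult.assoc case_prod_beta)

lemma rank_M_le_number_of_outer_powers:
  assumes "F = (\<Sum>m<r. outer_power (a m))"
  shows "rank_M F \<le> r"
proof -
  let ?b = "\<lambda>m. (\<chi> kl. a m $ fst kl * a m $ snd kl)"
  have "square_unfolding F $ row \<in> vec.span (?b ` {..<r})" for row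
  proof -
    have "square_unfolding F $ row = (\<Sum>m<r. (a m $ fst row * a m $ snd row) *s ?b m)"
      using square_unfolding_outer_powers[OF assms, of "fst row" "snd row"] by simp
    also have "\<dots> \<in> vec.span (?b ` {..<r})"
      by (intro vec.span_sum vec.span_scale vec.span_base) simp
    finally show ?thesis .
  qed
  then have "rows (square_unfolding F) \<subseteq> vec.span (?b ` {..<r})"
    by (auto simp: rows_def row_def)
  then have "vec.dim (rows (square_unfolding F)) \<le> card (?b ` {..<r})"
    by (rule vec.dim_le_card) simp
  then show ?thesis
    using card_image_le[of "{..<r}" ?b] by (simp add: rank_M_def row_rank_def_gen)
qed

lemma complex_nth_root_exists:
  assumes "0 < k" obtains t :: complex where "t ^ k = c"
proof (cases "c = 0")
  case False
  then have "exp (Ln c / of_nat k) ^ k = c"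
    using assms by (simp flip: exp_of_nat_mult)
  then show thesis using that by blast
qed (use that[of 0] assms in auto)

text \<open>
  The \<open>k\<close>-th outer power is homogeneous of degree \<open>k\<close>, so over the complex numbers a coefficient
  is absorbed by scaling the vector with a \<open>k\<close>-th root.
\<close>

lemma rank_SCP_le_card:
  fixes F :: "('n::finite, 'k::finite) tensor"
  assumes fin: "finite I" and F: "F = (\<Sum>m\<in>I. c m *s outer_power (a m))"
  shows "rank_SCP F \<le> enat (card I)"
proof -
  have "\<exists>b :: complex ^ 'n. outer_power b = c m *s (outer_power (a m) :: ('n, 'k) tensor)" for m
  proof -
    obtain t where "t ^ CARD('k) = c m"
      using complex_nth_root_exists[of "CARD('k)" "c m"] by auto
    then have "outer_power (t *s a m) = c m *s (outer_power (a m) :: ('n, 'k) tensor)"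
      by (simp add: outer_power_def vec_eq_iff prod.distrib)
    then show ?thesis by blast
  qed
  then obtain b where b: "\<And>m. outer_power (b m) = c m *s (outer_power (a m) :: ('n, 'k) tensor)"
    by metis
  obtain h where h: "bij_betw h {..<card I} I"
    using ex_bij_betw_nat_finite[OF fin] by (auto simp: atLeast0LessThan)
  have "F = (\<Sum>r<card I. outer_power ((b \<circ> h) r))"
    using sum.reindex_bij_betw[OF h, of "\<lambda>m. outer_power (b m) :: ('n, 'k) tensor"] by (simp add: F b[symmetric])
  then show ?thesis
    unfolding rank_SCP_def by (intro Inf_lower) blast
qed

text \<open>
  The left-hand side is the symmetrization of \<open>A \<otimes> A\<close> for the symmetric matrix
  \<open>A = (\<Sum>p\<in>I. u p (u p)\<^sup>T)\<close>, that is, the square of a sum of squares of linear forms. The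
  vectors \<open>u p + \<i> u q\<close> allow a sum over all ordered pairs \<open>(p, q)\<close>: by
  \<open>u q + \<i> u p = \<i> (u p - \<i> u q)\<close> and \<open>\<i>\<^sup>4 = 1\<close>, exchanging \<open>p\<close> and \<open>q\<close> has the effect of
  conjugating \<open>\<i>\<close>, and the odd terms cancel. The diagonal coefficient includes the pure fourth
  powers, as \<open>(1 + \<i>)\<^sup>4 = - 4\<close>.
\<close>

lemma symmetrized_square_eq_fourth_powers:
  fixes u :: "'i \<Rightarrow> complex ^ 'n" and I :: "'i set"
  assumes fin: "finite I"
  defines "S \<equiv> \<lambda>i j. \<Sum>p\<in>I. u p $ i * u p $ j"
  defines "c \<equiv> \<lambda>p q. if p = q then - 1 / 6 - of_nat (card I) / 12 else - 1 / 6"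
  shows "(S i j * S k l + S i k * S j l + S i l * S j k) / 3 =
    (\<Sum>p\<in>I. \<Sum>q\<in>I. c p q * (outer_power (u p + \<i> *s u q) $ multi_index4 i j k l))"
proof -
  \<comment> \<open>\<open>T p q + T q p\<close> sums the six placements of two copies each of \<open>u p\<close> and \<open>u q\<close>.\<close>
  define T where "T p q = (u p $ i * u p $ j) * (u q $ k * u q $ l) + (u p $ i * u p $ k) * (u q $ j * u q $ l)
    + (u p $ i * u p $ l) * (u q $ j * u q $ k)" for p q
  define P where "P p q = outer_power (u p + \<i> *s u q) $ multi_index4 i j k l" for p q
  define f where "f p = outer_power (u p) $ multi_index4 i j k l" for p
  define n :: complex where "n = of_nat (card I)"
  have prod: "S i j * S k l + S i k * S j l + S i l * S j k = (\<Sum>p\<in>I. \<Sum>q\<in>I. T p q)"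
    by (simp add: S_def T_def sum_product sum.distrib)
  have ii: "\<i> * (\<i> * z) = - z" for z by (simp flip: mult.assoc)
  have polar: "P p q + P q p = 2 * f p + 2 * f q - 2 * (T p q + T q p)" for p q
    unfolding P_def f_def T_def by (simp add: algebra_simps ii)
  have diag: "P p p = - 4 * f p" for p
    unfolding P_def f_def by (simp add: algebra_simps ii)
  have "2 * (\<Sum>p\<in>I. \<Sum>q\<in>I. P p q) = (\<Sum>p\<in>I. \<Sum>q\<in>I. P p q + P q p)"
    using sum.swap[of P I I] by (simp add: sum.distrib)
  also have "\<dots> = (\<Sum>p\<in>I. \<Sum>q\<in>I. 2 * f p) + (\<Sum>p\<in>I. \<Sum>q\<in>I. 2 * f q)
      - 2 * ((\<Sum>p\<in>I. \<Sum>q\<in>I. T p q) + (\<Sum>p\<in>I. \<Sum>q\<in>I. T q p))"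
    by (simp add: polar sum.distrib sum_subtractf sum_distrib_left distrib_left)
  also have "\<dots> = 4 * n * (\<Sum>p\<in>I. f p) - 4 * (\<Sum>p\<in>I. \<Sum>q\<in>I. T p q)"
    using sum.swap[of T I I] by (simp add: n_def sum_distrib_left sum_distrib_right mult_ac)
  finally have twice: "2 * (\<Sum>p\<in>I. \<Sum>q\<in>I. P p q) =
      4 * n * (\<Sum>p\<in>I. f p) - 4 * (\<Sum>p\<in>I. \<Sum>q\<in>I. T p q)" .
  have "(\<Sum>p\<in>I. \<Sum>q\<in>I. P p q) = 2 * (\<Sum>p\<in>I. \<Sum>q\<in>I. P p q) / 2"
    by simp
  also have "\<dots> = 2 * (n * (\<Sum>p\<in>I. f p) - (\<Sum>p\<in>I. \<Sum>q\<in>I. T p q))"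
    unfolding twice by (simp add: diff_divide_distrib)
  finally have key: "(\<Sum>p\<in>I. \<Sum>q\<in>I. T p q) = n * (\<Sum>p\<in>I. f p) - (\<Sum>p\<in>I. \<Sum>q\<in>I. P p q) / 2"
    by (simp add: diff_divide_distrib)
  have cP: "c p q * P p q = (- 1 / 6) * P p q + (if p = q then n / 3 * f p else 0)" for p q
    by (auto simp: c_def n_def diag field_simps)
  have "(\<Sum>p\<in>I. \<Sum>q\<in>I. c p q * P p q) =
      (- 1 / 6) * (\<Sum>p\<in>I. \<Sum>q\<in>I. P p q) + n / 3 * (\<Sum>p\<in>I. f p)"
    unfolding cP sum.distrib sum_distrib_left using fin by simp
  then show ?thesis
    unfolding prod key P_def[symmetric] by (simp add: field_simps)
qed

lemma rank_SCP_le_rank_M: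
  fixes F :: "('n::finite, 4) tensor"
  assumes "super_symmetric F"
  shows "rank_SCP F \<le> enat (CARD('n) ^ 2 * rank_M F)"
proof -
  note sw = super_symmetric_swap[OF assms]
  define n where "n = CARD('n)"
  define M where "M = square_unfolding F"
  define r where "r = rank_M F"
  have M: "M $ (i, j) $ (k, l) = F $ multi_index4 i j k l" for i j k l
    by (simp add: M_def square_unfolding_def)
  define W where "W = {y :: complex ^ ('n \<times> 'n). \<forall>i j. y $ (i, j) = y $ (j, i)}"
  define V where "V = vec.span (rows M)"
  have rowsW: "rows M \<subseteq> W"
    using sw(3) by (auto simp: W_def rows_def row_def M)
  have "vec.subspace W"
    by (auto simp: W_def vec.subspace_def)
  then have VW: "V \<subseteq> W"
    using rowsW by (simp add: V_def vec.span_minimal)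
  have Mrow: "M $ i \<in> V" for i
    unfolding V_def by (rule vec.span_base) (cases i, auto simp: rows_def row_def)
  have "F $ multi_index4 i j k l = F $ multi_index4 k l i j" for i j k l
    by (metis sw)
  then have Msym: "M $ i $ j = M $ j $ i" for i j
    by (cases i, cases j) (simp only: M)
  obtain x where x: "\<And>m. x m \<in> V" "\<And>i j. M $ i $ j = (\<Sum>m<r. x m $ i * x m $ j)"
    using symmetric_matrix_sum_squares[of V r M, OF _ _ Mrow Msym]
    by (auto simp: V_def r_def rank_M_def row_rank_def_gen M_def)
  have xsym: "x m $ (i, j) = x m $ (j, i)" for m i j
    using x(1)[of m] VW by (auto simp: W_def)
  have "\<exists>u :: nat \<Rightarrow> complex ^ 'n. \<forall>i j. x m $ (i, j) = (\<Sum>p<n. u p $ i * u p $ j)" for m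
  proof -
    define A where "A = (\<chi> i j. x m $ (i, j))"
    have "vec.dim (UNIV :: (complex ^ 'n) set) \<le> n"
      by (simp only: vec_dim_card n_def)
    moreover have "A $ i $ j = A $ j $ i" for i j
      using xsym[of m i j] by (simp add: A_def)
    ultimately obtain u where "\<And>i j. A $ i $ j = (\<Sum>p<n. u p $ i * u p $ j)"
      using symmetric_matrix_sum_squares[of UNIV n A] by auto
    then show ?thesis by (auto simp: A_def)
  qed
  then obtain u :: "nat \<Rightarrow> nat \<Rightarrow> complex ^ 'n"
    where u: "\<And>m i j. x m $ (i, j) = (\<Sum>p<n. u m p $ i * u m p $ j)" by metis
  define I where "I = {..<r} \<times> {..<n} \<times> {..<n}"
  define c :: "nat \<times> nat \<times> nat \<Rightarrow> complex"
    where "c = (\<lambda>(m, p, q). if p = q then - 1 / 6 - of_nat n / 12 else - 1 / 6)"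
  define a where "a = (\<lambda>(m, p, q). u m p + \<i> *s u m q)"
  have "F = (\<Sum>t\<in>I. c t *s outer_power (a t))"
  proof (rule tensor4_eqI)
    fix i j k l
    let ?X = "\<lambda>m. x m $ (i, j) * x m $ (k, l) + x m $ (i, k) * x m $ (j, l) + x m $ (i, l) * x m $ (j, k)"
    have F: "F $ multi_index4 i j k l = (\<Sum>m<r. x m $ (i, j) * x m $ (k, l))" for i j k l
      using x(2) by (simp flip: M)
    have "F $ multi_index4 i k j l = F $ multi_index4 i j k l" "F $ multi_index4 i l j k = F $ multi_index4 i j k l"
      by (metis sw)+
    \<comment> \<open>A single summand \<open>x m \<otimes> x m\<close> need not be super-symmetric, only their sum is; averaging over
      the three pairings of the indices makes every summand super-symmetric.\<close>
    then have "F $ multi_index4 i j k l =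
        (F $ multi_index4 i j k l + F $ multi_index4 i k j l + F $ multi_index4 i l j k) / 3"
      by simp
    also have "\<dots> = (\<Sum>m<r. ?X m / 3)"
      unfolding F by (simp add: sum.distrib flip: sum_divide_distrib)
    also have "\<dots> = (\<Sum>m<r. \<Sum>p<n. \<Sum>q<n.
        c (m, p, q) * (outer_power (a (m, p, q)) $ multi_index4 i j k l))"
    proof (rule sum.cong[OF refl])
      fix m
      show "?X m / 3 = (\<Sum>p<n. \<Sum>q<n. c (m, p, q) * (outer_power (a (m, p, q)) $ multi_index4 i j k l))"
        using symmetrized_square_eq_fourth_powers[of "{..<n}" "u m" i j k l]
        by (simp only: u c_def a_def prod.case card_lessThan finite_lessThan)
    qed
    also have "\<dots> = (\<Sum>t\<in>I. c t *s outer_power (a t)) $ multi_index4 i j k l"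
      by (simp add: I_def sum.cartesian_product sum_component case_prod_beta del: outer_power_multi_index4)
    finally show "F $ multi_index4 i j k l = (\<Sum>t\<in>I. c t *s outer_power (a t)) $ multi_index4 i j k l" .
  qed
  then have "rank_SCP F \<le> enat (card I)"
    by (intro rank_SCP_le_card) (simp add: I_def)
  also have "card I = CARD('n) ^ 2 * rank_M F"
    by (simp add: I_def r_def n_def power2_eq_square card_cartesian_product)
  finally show ?thesis .
qed

theorem mainTheorem5:
  fixes F :: "('n::finite, 4) tensor"
  assumes "super_symmetric F"
  shows "enat (rank_M F) \<le> rank_SCP F \<and> rank_SCP F \<le> enat (CARD('n) ^ 2 * rank_M F)"
proof
  show "enat (rank_M F) \<le> rank_SCP F"
    unfolding rank_SCP_def by (rule Inf_greatest) (use rank_M_le_number_of_outer_powers in fastforce)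
  show "rank_SCP F \<le> enat (CARD('n) ^ 2 * rank_M F)"
    using assms by (rule rank_SCP_le_rank_M)
qed

end
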